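(* Let $f:\mathbb{R}^m\to(-\infty,+\infty]$ and $g:\mathbb{R}^n\to(-\infty,+\infty]$ be proper lower semicontinuous convex functions, $A\in\mathbb{R}^{n\times m}$, and let $R,S\in\mathbb{R}^{n\times n}$ be symmetric positive definite with $A^TRA$ positive definite. Put $L(x,y)=f(x)+\langle Ax,y\rangle-g(y)$. Let $(\tau_k)_{k\ge0}$ and $(\lambda_k)_{k\ge0}$ be nondecreasing sequences of positive numbers with $R-\tau_k\lambda_kS^{-1}\succ0$ for all $k$. Let $(x^{k+1},y^{k+1},\overline y^{k+1})_{k\ge0}$ be an inexact primal-dual sequence (defined in the context) with tolerances $\varepsilon_k,\delta_k\ge0$ ($k\ge 1$) and starting point $(x^0,\overline y^0)$, and for $N\ge1$ put $\widehat x^N=\frac1N\sum_{k=0}^{N-1}x^{k+1}$, $\widehat y^N=\frac1N\sum_{k=0}^{N-1}y^{k+1}$. Then for every saddle point $(x^*,y^* )\in\mathbb{R}^m\times\mathbb{R}^n$ of $L$ and every $N\ge1$, $$L(\widehat x^N,y^* )-L(x^*,\widehat y^N)\le\frac{1}{2N\tau_N}\left[\sqrt{\frac{\tau_N}{\tau_0}}\,\|y^*-\overline y^0\|_S+\sqrt{\frac{\tau_N}{\lambda_0}}\,\|x^*-x^0\|_{A^TRA}+2A_N+\sqrt{2B_N}\right]^2,$$ where $A_N=\sum_{k=0}^{N-1}\tau_N\sqrt{\frac{\varepsilon_{k+1}}{\tau_k}}$ and $B_N=\sum_{k=0}^{N-1}\tau_N(2\varepsilon_{k+1}+\delta_{k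+1})$.
   Context: For a symmetric positive definite matrix $D$, $\|x\|_D^2=\langle x,Dx\rangle$; $M\succ0$ means that the symmetric matrix $M$ is positive definite. For a proper convex function $h$ and $\varepsilon\ge0$, the $\varepsilon$-subdifferential at $z\in\operatorname{dom}h$ is $\partial_\varepsilon h(z)=\{p: h(x)\ge h(z)+\langle p,x-z\rangle-\varepsilon\ \ \forall x\}$ (it is empty for $z\notin\operatorname{dom} h$). A point $(x^*,y^* )$ with $x^*\in\operatorname{dom}f$, $y^*\in\operatorname{dom}g$ is a saddle point of $L$ if $L(x^*,y)\le L(x^*,y^* )\le L(x,y^* )$ for all $x\in\mathbb{R}^m$, $y\in\mathbb{R}^n$. Inexact primal-dual sequence: given $x^0\in\mathbb{R}^m$, $\overline y^0\in\mathbb{R}^n$, step sizes $\tau_k,\lambda_k>0$ and tolerances $\varepsilon_{k+1},\delta_{k+1}\ge0$, a sequence $(x^{k+1},y^{k+1},\overline y^{k+1})_{k\ge0}$ is called an inexact primal-dual sequence if for every $k\ge0$: (1) $y^{k+1}$ is a type-2 approximation, with precision $\varepsilon_{k+1}/2$, of $\arg\max_y\{L(x^k,y)-\frac1{2\tau_k}\|y-\overline y^k\|_S^2\}$, i.e. $\frac1{\tau_k}S(\overline y^k-y^{k+1})+Ax^k\in\partial_{\varepsilon_{k+1}/2}\,g(y^{k+1})$; (2) $x^{k+1}$ is a type-2 approximation, with precision $\delta_{k+1}$, of $\arg\min_x\{L(x,y^{k+1})+\frac1{2\lambda_k}\|A(x-x^k)\|_R^2\}$, i.e. $\frac1{\lambda_k}A^TRA(x^k-x^{k+1})-A^Ty^{k+1}\in\partial_{\delta_{k+1}}f(x^{k+1})$;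 (3) $\overline y^{k+1}$ is a type-1 approximation, with precision $\varepsilon_{k+1}/2$, of $\arg\max_y\{L(x^{k+1},y)-\frac1{2\tau_k}\|y-\overline y^k\|_S^2\}$, i.e. $0\in\partial_{\varepsilon_{k+1}/2}\,G(\overline y^{k+1})$, where $G(y)=g(y)-\langle Ax^{k+1},y\rangle+\frac1{2\tau_k}\|y-\overline y^k\|_S^2$. *)

theory Defs
  imports "HOL-Analysis.Analysis"
begin

definition edom :: "('a \<Rightarrow> ereal) \<Rightarrow> 'a set" where
  "edom h = {x. h x < \<infinity>}"

definition proper :: "('a \<Rightarrow> ereal) \<Rightarrow> bool" where
  "proper h \<longleftrightarrow> (\<forall>x. h x \<noteq> -\<infinity>) \<and> edom h \<noteq> {}"

(* The library convex_on is for real-valued functions only. In ereal, 0 * \<infinity> = 0, so u = 0 and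
   v = 0 are harmless, and for proper h the right-hand side never has the form \<infinity> + (-\<infinity>). *)
definition convex_fun :: "('a::real_vector \<Rightarrow> ereal) \<Rightarrow> bool" where
  "convex_fun h \<longleftrightarrow>
     (\<forall>x y. \<forall>u v :: real. 0 \<le> u \<longrightarrow> 0 \<le> v \<longrightarrow> u + v = 1 \<longrightarrow>
        h (u *\<^sub>R x + v *\<^sub>R y) \<le> ereal u * h x + ereal v * h y)"

definition lower_semicontinuous :: "('a::topological_space \<Rightarrow> ereal) \<Rightarrow> bool" where
  "lower_semicontinuous h \<longleftrightarrow> (\<forall>x. h x \<le> Liminf (at x) h)"

definition eps_subdiff :: "real \<Rightarrow> ('a::real_inner \<Rightarrow> ereal) \<Rightarrow> 'a \<Rightarrow> 'a set" where
  "eps_subdiff e h z =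
     {p. z \<in> edom h \<and> (\<forall>x. h x \<ge> h z + ereal (p \<bullet> (x - z)) - ereal e)}"

definition pos_def :: "real^'n^'n \<Rightarrow> bool" where
  "pos_def M \<longleftrightarrow> transpose M = M \<and> (\<forall>x. x \<noteq> 0 \<longrightarrow> x \<bullet> (M *v x) > 0)"

definition wnorm :: "real^'n^'n \<Rightarrow> real^'n \<Rightarrow> real" where
  "wnorm D x = sqrt (x \<bullet> (D *v x))"

(* In ereal, \<infinity> - \<infinity> = \<infinity>; this convention only concerns points with x \<notin> edom f and y \<notin> edom g. *)
definition Lagr ::
  "(real^'m \<Rightarrow> ereal) \<Rightarrow> (real^'n \<Rightarrow> ereal) \<Rightarrow> real^'m^'n \<Rightarrow> real^'m \<Rightarrow> real^'n \<Rightarrow> ereal" where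
  "Lagr f g A x y = f x + ereal ((A *v x) \<bullet> y) - g y"

definition saddle_point ::
  "(real^'m \<Rightarrow> ereal) \<Rightarrow> (real^'n \<Rightarrow> ereal) \<Rightarrow> real^'m^'n \<Rightarrow> real^'m \<Rightarrow> real^'n \<Rightarrow> bool" where
  "saddle_point f g A xs ys \<longleftrightarrow>
     xs \<in> edom f \<and> ys \<in> edom g \<and>
     (\<forall>x y. Lagr f g A xs y \<le> Lagr f g A xs ys \<and> Lagr f g A xs ys \<le> Lagr f g A x ys)"

(* The starting point is (x 0, yb 0); y 0, \<epsilon> 0 and \<delta> 0 play no role. In order, the inclusions
   say: y (Suc k) is a type-2 approximation of the regularized maximizer in the dual variable at x k,
   x (Suc k) a type-2 approximation of the regularized minimizer in the primal variable at y (Suc k),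
   and yb (Suc k) a type-1 approximation of the regularized maximizer in the dual variable
   at x (Suc k). Type 2 puts the error into the subdifferential of g or f alone; type 1 into that of
   the full objective. *)
definition inexact_pd_seq ::
  "(real^'m \<Rightarrow> ereal) \<Rightarrow> (real^'n \<Rightarrow> ereal) \<Rightarrow> real^'m^'n \<Rightarrow> real^'n^'n \<Rightarrow> real^'n^'n \<Rightarrow>
   (nat \<Rightarrow> real) \<Rightarrow> (nat \<Rightarrow> real) \<Rightarrow> (nat \<Rightarrow> real) \<Rightarrow> (nat \<Rightarrow> real) \<Rightarrow>
   (nat \<Rightarrow> real^'m) \<Rightarrow> (nat \<Rightarrow> real^'n) \<Rightarrow> (nat \<Rightarrow> real^'n) \<Rightarrow> bool" where
  "inexact_pd_seq f g A R S \<tau> lam \<epsilon> \<delta> x y yb \<longleftrightarrow>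
     (\<forall>k.
       (1 / \<tau> k) *\<^sub>R (S *v (yb k - y (Suc k))) + A *v x k
         \<in> eps_subdiff (\<epsilon> (Suc k) / 2) g (y (Suc k)) \<and>
       (1 / lam k) *\<^sub>R ((transpose A ** R ** A) *v (x k - x (Suc k))) - transpose A *v y (Suc k)
         \<in> eps_subdiff (\<delta> (Suc k)) f (x (Suc k)) \<and>
       0 \<in> eps_subdiff (\<epsilon> (Suc k) / 2)
             (\<lambda>v. g v - ereal ((A *v x (Suc k)) \<bullet> v)
                   + ereal (1 / (2 * \<tau> k) * (wnorm S (v - yb k))\<^sup>2))
             (yb (Suc k)))"

end

theory Submission
  imports Defs
begin

text \<open>Testing the inclusion for \<open>y (Suc k)\<close> at \<open>yb (Suc k)\<close>, the one for \<open>yb (Suc k)\<close> at \<open>ys\<close> and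
  the one for \<open>x (Suc k)\<close> at \<open>xs\<close>, and adding up, bounds the gap of step \<open>k\<close> by telescoping squared
  distances plus errors; the remaining coupling term is absorbed by Young's inequality and the
  condition on \<open>R\<close> and \<open>S\<close>. One error term is proportional to the distance of \<open>yb (Suc k)\<close> to
  \<open>ys\<close>; since the gaps are nonnegative, the summed estimate also bounds these distances. Convexity
  carries the bound over to the averages.\<close>

section \<open>Proper convex functions as real functions on their effective domains\<close>

lemma proper_real_ereal:
  assumes "proper h" "z \<in> edom h"
  shows "ereal (real_of_ereal (h z)) = h z"
  using assms by (cases "h z") (auto simp: proper_def edom_def)

lemma eps_subdiff_realD:
  assumes "proper h" "p \<in> eps_subdiff e h z" "v \<in> edom h"
  shows "real_of_ereal (h z) + p \<bullet> (v - z) - e \<le> real_of_ereal (h v)"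
proof -
  have z: "z \<in> edom h" and le: "h z + ereal (p \<bullet> (v - z)) - ereal e \<le> h v"
    using assms(2) by (auto simp: eps_subdiff_def)
  show ?thesis
    using le proper_real_ereal[OF assms(1) z] proper_real_ereal[OF assms(1,3)]
    by (metis ereal_less_eq(3) ereal_minus(1) plus_ereal.simps(1))
qed

lemma convex_fun_realD:
  assumes "proper h" "convex_fun h" "a \<in> edom h" "b \<in> edom h" "0 \<le> u" "0 \<le> v" "u + v = 1"
  shows "u *\<^sub>R a + v *\<^sub>R b \<in> edom h"
    and "real_of_ereal (h (u *\<^sub>R a + v *\<^sub>R b)) \<le> u * real_of_ereal (h a) + v * real_of_ereal (h b)"
proof -
  have "h (u *\<^sub>R a + v *\<^sub>R b) \<le> ereal u * h a + ereal v * h b"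
    using assms(2,5-7) by (simp add: convex_fun_def)
  also have "\<dots> = ereal (u * real_of_ereal (h a) + v * real_of_ereal (h b))"
    by (subst (1 2) proper_real_ereal[OF assms(1), symmetric]) (simp_all add: assms(3,4))
  finally have le: "h (u *\<^sub>R a + v *\<^sub>R b)
      \<le> ereal (u * real_of_ereal (h a) + v * real_of_ereal (h b))" .
  then show dom: "u *\<^sub>R a + v *\<^sub>R b \<in> edom h"
    unfolding edom_def mem_Collect_eq by (rule order_le_less_trans) simp
  show "real_of_ereal (h (u *\<^sub>R a + v *\<^sub>R b)) \<le> u * real_of_ereal (h a) + v * real_of_ereal (h b)"
    using le unfolding ereal_less_eq(3)[symmetric] proper_real_ereal[OF assms(1) dom] .
qed

lemma convex_on_real_of_ereal:
  assumes "proper h" "convex_fun h"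
  shows "convex_on (edom h) (\<lambda>z. real_of_ereal (h z))"
  using convex_fun_realD[OF assms] by (auto simp: convex_on_def convex_def)

lemma convex_fun_average:
  assumes "proper h" "convex_fun h" "N \<ge> 1" "\<And>k. k < N \<Longrightarrow> z k \<in> edom h"
  shows "(1 / real N) *\<^sub>R (\<Sum>k<N. z k) \<in> edom h"
    and "real_of_ereal (h ((1 / real N) *\<^sub>R (\<Sum>k<N. z k)))
           \<le> (1 / real N) * (\<Sum>k<N. real_of_ereal (h (z k)))"
proof -
  have cvx: "convex_on (edom h) (\<lambda>z. real_of_ereal (h z))"
    using assms(1,2) by (rule convex_on_real_of_ereal)
  have one: "(\<Sum>k<N. 1 / real N) = 1" using assms(3) by simp
  show "(1 / real N) *\<^sub>R (\<Sum>k<N. z k) \<in> edom h"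
    unfolding scaleR_sum_right
    by (rule convex_sum) (use cvx one assms(4) in \<open>auto simp: convex_on_def\<close>)
  show "real_of_ereal (h ((1 / real N) *\<^sub>R (\<Sum>k<N. z k)))
           \<le> (1 / real N) * (\<Sum>k<N. real_of_ereal (h (z k)))"
    unfolding scaleR_sum_right sum_distrib_left
    by (rule convex_on_sum[OF _ _ cvx]) (use one assms(3,4) in \<open>auto simp: lessThan_empty_iff\<close>)
qed

section \<open>Weighted norms and the coupling estimate\<close>

lemma pos_def_sym:
  assumes "pos_def S"
  shows "(S *v a) \<bullet> b = (S *v b) \<bullet> a"
  using assms by (metis dot_lmul_matrix inner_commute pos_def_def transpose_matrix_vector)

lemma pos_def_nonneg: "pos_def S \<Longrightarrow> 0 \<le> a \<bullet> (S *v a)"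
  by (cases "a = 0") (auto simp: pos_def_def less_imp_le)

lemma wnorm_nonneg: "pos_def S \<Longrightarrow> 0 \<le> wnorm S a"
  by (simp add: wnorm_def pos_def_nonneg)

lemma wnorm_sq: "pos_def S \<Longrightarrow> (wnorm S a)\<^sup>2 = (S *v a) \<bullet> a"
  by (simp add: wnorm_def pos_def_nonneg inner_commute)

lemma wnorm_minus_commute: "wnorm S (a - b) = wnorm S (b - a)"
proof -
  have "(a - b) \<bullet> (S *v (a - b)) = (b - a) \<bullet> (S *v (b - a))"
    by (simp add: matrix_vector_mult_diff_distrib algebra_simps inner_diff)
  then show ?thesis by (simp add: wnorm_def)
qed

lemma wnorm_add_scaleR_sq:
  assumes "pos_def S"
  shows "(wnorm S (p + s *\<^sub>R d))\<^sup>2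
           = (wnorm S p)\<^sup>2 + 2 * s * ((S *v p) \<bullet> d) + s\<^sup>2 * (wnorm S d)\<^sup>2"
  using pos_def_sym[OF assms, of d p]
  unfolding wnorm_sq[OF assms]
  by (simp add: matrix_vector_right_distrib matrix_vector_mult_scaleR inner_add
      power2_eq_square algebra_simps)

text \<open>The law of cosines. It converts the pairings with proximal residuals in
  \<open>pd_step\<close> into differences of squared distances.\<close>

lemma wnorm_three_point:
  assumes "pos_def S"
  shows "2 * ((S *v (a - z)) \<bullet> (b - z))
           = (wnorm S (a - z))\<^sup>2 + (wnorm S (b - z))\<^sup>2 - (wnorm S (a - b))\<^sup>2"
  using pos_def_sym[OF assms, of a b] pos_def_sym[OF assms, of a z] pos_def_sym[OF assms, of b z]
  by (simp add: wnorm_sq[OF assms] matrix_vector_mult_diff_distrib inner_diff)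

lemma pos_def_invertible:
  assumes "pos_def S"
  shows "invertible S"
proof -
  have "\<forall>x. S *v x = 0 \<longrightarrow> x = 0"
    using assms by (metis inner_zero_right less_irrefl pos_def_def)
  then show ?thesis
    by (metis invertible_left_inverse matrix_left_invertible_ker)
qed

text \<open>Completing the square: the form of \<open>S\<close> is nonnegative at \<open>w\<close>
  minus \<open>t\<close> times the preimage of \<open>u\<close> under \<open>S\<close>. The inverse
  enters because its form is conjugate to that of \<open>S\<close>.\<close>

lemma pos_def_young:
  assumes "pos_def S" "t > 0"
  shows "u \<bullet> w \<le> (wnorm S w)\<^sup>2 / (2 * t) + t / 2 * (u \<bullet> (matrix_inv S *v u))"
proof -
  define v where "v = matrix_inv S *v u"
  \<comment> \<open>\<open>matrix_inv\<close> is given by a choice operator, so its inverse property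
    has to be extracted from invertibility.\<close>
  have Sv: "S *v v = u"
    using pos_def_invertible[OF assms(1)]
    unfolding v_def matrix_vector_mul_assoc matrix_inv_def invertible_def
    by (rule someI2_ex) auto
  have "0 \<le> (w - t *\<^sub>R v) \<bullet> (S *v (w - t *\<^sub>R v))"
    using assms(1) by (rule pos_def_nonneg)
  also have "\<dots> = (S *v w) \<bullet> w - 2 * t * (u \<bullet> w) + t\<^sup>2 * (u \<bullet> v)"
    using pos_def_sym[OF assms(1), of w v]
    by (simp add: matrix_vector_mult_diff_distrib matrix_vector_mult_scaleR Sv inner_diff
        inner_commute power2_eq_square algebra_simps)
  finally have "2 * t * (u \<bullet> w) \<le> (wnorm S w)\<^sup>2 + t\<^sup>2 * (u \<bullet> v)"
    by (simp add: wnorm_sq[OF assms(1)])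
  then show ?thesis
    using assms(2) by (simp add: v_def field_simps power2_eq_square)
qed

text \<open>Young's inequality yields the form of \<open>matrix_inv S\<close> at
  \<open>A *v d\<close> with factor \<open>t / 2\<close>. The hypothesis on \<open>R\<close> trades
  it for the form of \<open>R\<close> with factor \<open>1 / (2 * l)\<close>, which at
  \<open>A *v d\<close> is the weighted norm of \<open>d\<close>. The resulting squares are exactly
  those that \<open>pd_step\<close> holds in reserve.\<close>

lemma coupling_bound:
  fixes A :: "real^'m^'n" and R S :: "real^'n^'n"
  assumes "pos_def S" "pos_def (transpose A ** R ** A)" "t > 0" "l > 0"
    and "pos_def (R - (t * l) *\<^sub>R matrix_inv S)"
  shows "(A *v d) \<bullet> w \<le> (wnorm S w)\<^sup>2 / (2 * t) + (wnorm (transpose A ** R ** A) d)\<^sup>2 / (2 * l)"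
proof -
  let ?u = "A *v d"
  have "0 \<le> ?u \<bullet> ((R - (t * l) *\<^sub>R matrix_inv S) *v ?u)"
    using assms(5) by (rule pos_def_nonneg)
  then have "t * l * (?u \<bullet> (matrix_inv S *v ?u)) \<le> ?u \<bullet> (R *v ?u)"
    by (simp add: matrix_vector_mult_diff_rdistrib scaleR_matrix_vector_assoc[symmetric] inner_diff)
  also have "\<dots> = (wnorm (transpose A ** R ** A) d)\<^sup>2"
    unfolding wnorm_sq[OF assms(2)]
    by (simp add: matrix_vector_mul_assoc[symmetric] dot_lmul_matrix inner_commute[of _ "R *v _"])
  finally have "t / 2 * (?u \<bullet> (matrix_inv S *v ?u)) \<le> (wnorm (transpose A ** R ** A) d)\<^sup>2 / (2 * l)"
    using assms(4) by (simp add: field_simps)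
  with pos_def_young[OF assms(1,3), of ?u w] show ?thesis by linarith
qed

section \<open>Type-1 approximations\<close>

text \<open>Dividing by \<open>s\<close> bounds \<open>- \<alpha>\<close> by
  \<open>e / (2 * s) + s * d\<^sup>2 / (2 * t)\<close>. The optimal \<open>s\<close> is
  \<open>sqrt (e * t) / d\<close> and makes this \<open>sqrt (e / t) * d\<close>. When it exceeds 1,
  the endpoint \<open>s = 1\<close> is taken instead, at the price of the extra
  \<open>e / 2\<close>.\<close>

lemma quadratic_perturbation_bound:
  fixes \<alpha> d e t :: real
  assumes "t > 0" "e \<ge> 0" "d \<ge> 0"
    and ineq: "\<And>s. 0 < s \<Longrightarrow> s \<le> 1 \<Longrightarrow> - (e / 2) \<le> s * \<alpha> + s\<^sup>2 / (2 * t) * d\<^sup>2"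
  shows "- (sqrt (e / t) * d) - e / 2 \<le> \<alpha>"
proof -
  define r where "r = sqrt (e / t)"
  have r: "r \<ge> 0" "e = r\<^sup>2 * t" using assms(1,2) by (auto simp: r_def)
  \<comment> \<open>With \<open>d > 0\<close> the optimal \<open>s\<close> is
    \<open>r * t / d\<close>: at least 1 in the first case (which also takes in
    \<open>d = 0\<close>), strictly between 0 and 1 in the second, and degenerate in the third,
    where \<open>e = 0\<close>.\<close>
  consider "d \<le> r * t" | "r * t < d" "r > 0" | "d > 0" "r = 0"
    using r(1) assms(3) by (cases "r = 0"; cases "d = 0") (auto simp: not_le[symmetric])
  then have "- (r * d) - e / 2 \<le> \<alpha>"
  proof cases
    case 1
    have "d\<^sup>2 / (2 * t) \<le> r * d / 2"
      using mult_right_mono[OF 1 assms(3)] assms(1) by (simp add: field_simps power2_eq_square)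
    moreover have "0 \<le> r * d" using r(1) assms(3) by simp
    ultimately show ?thesis using ineq[of 1] by simp
  next
    case 2
    then have d: "d > 0" using assms(1) by (smt (verit) mult_pos_pos)
    define s where "s = r * t / d"
    have s: "0 < s" "s \<le> 1" using 2 d assms(1) by (auto simp: s_def)
    have "s * (r * d) = e" "s\<^sup>2 / (2 * t) * d\<^sup>2 = e / 2"
      using d assms(1) by (auto simp: s_def r(2) power2_eq_square field_simps)
    then have "0 \<le> s * (\<alpha> + r * d)"
      using ineq[OF s] by (simp add: algebra_simps)
    then have "0 \<le> \<alpha> + r * d" using s(1) by (simp add: zero_le_mult_iff)
    then show ?thesis using assms(2) by linarith
  next
    case 3
    have "0 \<le> \<alpha>"
    proof (rule ccontr)
      assume neg: "\<not> 0 \<le> \<alpha>"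
      \<comment> \<open>Small enough that the quadratic term, divided by \<open>s\<close>, is at
        most half of \<open>- \<alpha>\<close>.\<close>
      define s where "s = min 1 (- \<alpha> * t / d\<^sup>2)"
      have s: "0 < s" "s \<le> 1" "s \<le> - \<alpha> * t / d\<^sup>2"
        using neg 3 assms(1) unfolding s_def
        by (auto simp: mult_less_0_iff divide_less_0_iff)
      have "0 \<le> s * (\<alpha> + s * d\<^sup>2 / (2 * t))"
        using ineq[OF s(1,2)] r(2) 3 by (simp add: algebra_simps power2_eq_square)
      then have "0 \<le> \<alpha> + s * d\<^sup>2 / (2 * t)" using s(1) by (simp add: zero_le_mult_iff)
      moreover have "s * d\<^sup>2 / (2 * t) \<le> - \<alpha> / 2"
        using mult_right_mono[OF s(3), of "d\<^sup>2"] 3 assms(1)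
        by (simp add: divide_le_eq mult.commute)
      ultimately show False using neg by linarith
    qed
    then show ?thesis using 3 assms(2) by simp
  qed
  then show ?thesis by (simp add: r_def)
qed

text \<open>This replaces the sum rule for \<open>\<epsilon>\<close>-subdifferentials: comparing the approximate minimizer only
  with points of the segment towards \<open>v\<close> avoids any duality argument.\<close>

lemma type1_approximation:
  fixes h :: "real^'n \<Rightarrow> ereal"
  assumes "proper h" "convex_fun h" "pos_def S" "t > 0" "e \<ge> 0"
    and approx: "0 \<in> eps_subdiff (e / 2)
           (\<lambda>v. h v - ereal (a \<bullet> v) + ereal (1 / (2 * t) * (wnorm S (v - c))\<^sup>2)) z"
    and "v \<in> edom h"
  shows "z \<in> edom h"
    and "real_of_ereal (h z) + ((1 / t) *\<^sub>R (S *v (c - z)) + a) \<bullet> (v - z)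
           - sqrt (e / t) * wnorm S (v - z) - e / 2 \<le> real_of_ereal (h v)"
proof -
  define q where "q w = 1 / (2 * t) * (wnorm S (w - c))\<^sup>2 - a \<bullet> w" for w
  let ?h = "\<lambda>w. real_of_ereal (h w)"
  show z: "z \<in> edom h"
    using approx by (cases "h z") (auto simp: eps_subdiff_def edom_def)
  have min: "?h z + q z - e / 2 \<le> ?h w + q w" if w: "w \<in> edom h" for w
  proof -
    have "h z - ereal (a \<bullet> z) + ereal (1 / (2 * t) * (wnorm S (z - c))\<^sup>2) - ereal (e / 2)
        \<le> h w - ereal (a \<bullet> w) + ereal (1 / (2 * t) * (wnorm S (w - c))\<^sup>2)"
      using approx by (auto simp: eps_subdiff_def)
    moreover obtain b b' where "h z = ereal b" "h w = ereal b'"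
      using proper_real_ereal[OF assms(1) z] proper_real_ereal[OF assms(1) w] by metis
    ultimately show ?thesis by (simp add: q_def)
  qed
  let ?g = "((1 / t) *\<^sub>R (S *v (c - z)) + a) \<bullet> (v - z)"
  \<comment> \<open>The scalar lemma is applied to the defect \<open>?h v - ?h z - ?g\<close>. From
    \<open>z\<close> towards \<open>v\<close>, convexity bounds the increase of \<open>?h\<close> by
    \<open>s * (?h v - ?h z)\<close>, while \<open>q\<close> changes exactly by
    \<open>- s * ?g\<close> plus the quadratic term.\<close>
  have "- (sqrt (e / t) * wnorm S (v - z)) - e / 2 \<le> ?h v - ?h z - ?g"
  proof (rule quadratic_perturbation_bound[OF assms(4,5) wnorm_nonneg[OF assms(3)]])
    fix s :: real
    assume s: "0 < s" "s \<le> 1"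
    define w where "w = (1 - s) *\<^sub>R z + s *\<^sub>R v"
    have dom: "w \<in> edom h" and cv: "?h w \<le> (1 - s) * ?h z + s * ?h v"
      unfolding w_def using convex_fun_realD[OF assms(1,2) z assms(7), of "1 - s" s] s by auto
    have w: "w = z + s *\<^sub>R (v - z)" by (simp add: w_def algebra_simps)
    define g1 g2 n where "g1 = (S *v (c - z)) \<bullet> (v - z)" "g2 = a \<bullet> (v - z)"
      "n = wnorm S (v - z)"
    note defs = g1_g2_n_def
    have eq: "w - c = (z - c) + s *\<^sub>R (v - z)" by (simp add: w)
    have "(S *v (z - c)) \<bullet> (v - z) = - g1"
      by (simp add: defs matrix_vector_mult_diff_distrib inner_diff)
    then have sq: "(wnorm S (w - c))\<^sup>2 = (wnorm S (z - c))\<^sup>2 - 2 * s * g1 + s\<^sup>2 * n\<^sup>2"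
      using wnorm_add_scaleR_sq[OF assms(3), of "z - c" s "v - z"] unfolding eq defs(3) by simp
    have lin: "a \<bullet> w = a \<bullet> z + s * g2" by (simp add: w inner_add_right defs)
    have "q w = q z - s * (g1 / t + g2) + s\<^sup>2 / (2 * t) * n\<^sup>2"
      unfolding q_def sq lin using assms(4) by (simp add: field_simps)
    moreover have "?g = g1 / t + g2" by (simp add: inner_add_left defs)
    ultimately have "q w = q z - s * ?g + s\<^sup>2 / (2 * t) * (wnorm S (v - z))\<^sup>2"
      by (simp add: defs(3))
    with min[OF dom] cv
    show "- (e / 2) \<le> s * (?h v - ?h z - ?g) + s\<^sup>2 / (2 * t) * (wnorm S (v - z))\<^sup>2"
      by (simp add: algebra_simps)
  qed
  then show "?h z + ?g - sqrt (e / t) * wnorm S (v - z) - e / 2 \<le> ?h v"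
    by linarith
qed

section \<open>One step of the iteration\<close>

text \<open>In the sum of \<open>i1\<close>, \<open>i2\<close> and \<open>i3\<close> the square of
  \<open>yb - yb'\<close> cancels between \<open>p\<close> and \<open>q\<close>. The bilinear
  remainder is paid for by the squares of \<open>yb' - y'\<close> and \<open>x' - x\<close> in
  \<open>p\<close> and \<open>r\<close>, so that only distances to \<open>ys\<close> and
  \<open>xs\<close> survive.\<close>

lemma pd_step:
  fixes f :: "real^'m \<Rightarrow> ereal" and g :: "real^'n \<Rightarrow> ereal"
    and A :: "real^'m^'n" and R S :: "real^'n^'n"
  defines "M \<equiv> transpose A ** R ** A"
  assumes "proper f" "proper g" "convex_fun g" "pos_def S" "pos_def M" "t > 0" "l > 0" "e \<ge> 0"
    and RS: "pos_def (R - (t * l) *\<^sub>R matrix_inv S)"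
    and y: "(1 / t) *\<^sub>R (S *v (yb - y')) + A *v x \<in> eps_subdiff (e / 2) g y'"
    and x: "(1 / l) *\<^sub>R (M *v (x - x')) - transpose A *v y' \<in> eps_subdiff d f x'"
    and yb: "0 \<in> eps_subdiff (e / 2)
           (\<lambda>v. g v - ereal ((A *v x') \<bullet> v) + ereal (1 / (2 * t) * (wnorm S (v - yb))\<^sup>2)) yb'"
    and dom: "xs \<in> edom f" "ys \<in> edom g"
  shows "real_of_ereal (f x') + (A *v x') \<bullet> ys - real_of_ereal (g ys)
           - (real_of_ereal (f xs) + (A *v xs) \<bullet> y' - real_of_ereal (g y'))
         \<le> ((wnorm S (ys - yb))\<^sup>2 - (wnorm S (ys - yb'))\<^sup>2) / (2 * t)
           + ((wnorm M (xs - x))\<^sup>2 - (wnorm M (xs - x'))\<^sup>2) / (2 * l)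
           + sqrt (e / t) * wnorm S (ys - yb') + e + d"
proof -
  note t1 = type1_approximation[OF assms(3-5,7,9) yb dom(2)]
  define p where "p = (S *v (yb - y')) \<bullet> (yb' - y')"
  define q where "q = (S *v (yb - yb')) \<bullet> (ys - yb')"
  define r where "r = (M *v (x - x')) \<bullet> (xs - x')"
  have i1: "real_of_ereal (g y') + (p / t + (A *v x) \<bullet> (yb' - y')) - e / 2 \<le> real_of_ereal (g yb')"
    using eps_subdiff_realD[OF assms(3) y t1(1)] by (simp add: inner_add_left p_def)
  have i2: "real_of_ereal (g yb') + (q / t + (A *v x') \<bullet> (ys - yb'))
      - sqrt (e / t) * wnorm S (ys - yb') - e / 2 \<le> real_of_ereal (g ys)"
    using t1(2) by (simp add: inner_add_left q_def)
  have i3: "real_of_ereal (f x') + (r / l - (A *v (xs - x')) \<bullet> y') - d \<le> real_of_ereal (f xs)"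
    using eps_subdiff_realD[OF assms(2) x dom(1)]
    by (simp add: inner_diff_left dot_lmul_matrix inner_commute[of y'] r_def)
  have i4: "(A *v (x' - x)) \<bullet> (yb' - y')
      \<le> (wnorm S (yb' - y'))\<^sup>2 / (2 * t) + (wnorm M (x' - x))\<^sup>2 / (2 * l)"
    using coupling_bound[OF assms(5) _ assms(7,8) RS] assms(6) unfolding M_def by blast
  have p: "p / t = (wnorm S (yb - y'))\<^sup>2 / (2 * t) + (wnorm S (yb' - y'))\<^sup>2 / (2 * t)
      - (wnorm S (yb - yb'))\<^sup>2 / (2 * t)"
    using arg_cong[OF wnorm_three_point[OF assms(5), of yb y' yb'], of "\<lambda>s. s / (2 * t)"]
    by (simp add: p_def add_divide_distrib diff_divide_distrib)
  have q: "q / t = (wnorm S (yb - yb'))\<^sup>2 / (2 * t) + (wnorm S (ys - yb'))\<^sup>2 / (2 * t)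
      - (wnorm S (ys - yb))\<^sup>2 / (2 * t)"
    using arg_cong[OF wnorm_three_point[OF assms(5), of yb yb' ys], of "\<lambda>s. s / (2 * t)"]
      wnorm_minus_commute[of S yb ys]
    by (simp add: q_def add_divide_distrib diff_divide_distrib)
  have r: "r / l = (wnorm M (x' - x))\<^sup>2 / (2 * l) + (wnorm M (xs - x'))\<^sup>2 / (2 * l)
      - (wnorm M (xs - x))\<^sup>2 / (2 * l)"
    using arg_cong[OF wnorm_three_point[OF assms(6), of x x' xs], of "\<lambda>s. s / (2 * l)"]
      wnorm_minus_commute[of M x xs] wnorm_minus_commute[of M x x']
    by (simp add: r_def add_divide_distrib diff_divide_distrib)
  have nn: "0 \<le> (wnorm S (yb - y'))\<^sup>2 / (2 * t)" using assms(7) by simp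
  \<comment> \<open>A product of two differences, because \<open>y'\<close> is computed at
    \<open>x\<close> but \<open>yb'\<close> at \<open>x'\<close>.\<close>
  have bil: "(A *v x') \<bullet> ys - (A *v xs) \<bullet> y' - (A *v x) \<bullet> (yb' - y') - (A *v x') \<bullet> (ys - yb')
      + (A *v (xs - x')) \<bullet> y' = (A *v (x' - x)) \<bullet> (yb' - y')"
    by (simp add: matrix_vector_mult_diff_distrib inner_diff)
  show ?thesis
    unfolding diff_divide_distrib using i1 i2 i3 i4 p q r nn bil by linarith
qed

section \<open>Summing the step estimates\<close>

text \<open>Summation by parts: the remainders \<open>a (Suc k) * (w (Suc k) - w k)\<close> are
  nonpositive. With weights \<open>1 / (2 * t k)\<close> this is how nondecreasing step sizes are
  exploited.\<close>

lemma telescope_decreasing_weights: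
  fixes a w :: "nat \<Rightarrow> real"
  assumes "\<And>k. 0 \<le> a k" "\<And>k. w (Suc k) \<le> w k"
  shows "(\<Sum>k<n. (a k - a (Suc k)) * w k) \<le> a 0 * w 0 - a n * w n"
proof (induction n)
  case (Suc n)
  have "a (Suc n) * w (Suc n) \<le> a (Suc n) * w n"
    using assms by (intro mult_left_mono) auto
  with Suc show ?case by (simp add: algebra_simps)
qed simp

text \<open>If \<open>U\<close> exceeded \<open>2 * A + w\<close>, then
  \<open>U * (U - 2 * A)\<close> would exceed \<open>U * w\<close>, hence \<open>w\<^sup>2\<close>.
  Bounding \<open>U\<close> by this sum instead of the exact root makes the result a perfect
  square.\<close>

lemma quadratic_growth_bound:
  fixes U A w :: real
  assumes "0 \<le> A" "0 \<le> w" "0 \<le> U" "U\<^sup>2 \<le> w\<^sup>2 + 2 * A * U"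
  shows "w\<^sup>2 + 2 * A * U \<le> (2 * A + w)\<^sup>2"
proof -
  have "U \<le> 2 * A + w"
  proof (rule ccontr)
    assume c: "\<not> U \<le> 2 * A + w"
    then have "w * w \<le> U * w" "w * U < (U - 2 * A) * U"
      using assms by (auto intro!: mult_right_mono mult_strict_right_mono)
    then show False using assms(4) by (simp add: algebra_simps power2_eq_square)
  qed
  then have "A * U \<le> A * (2 * A + w)" using assms(1) by (rule mult_left_mono)
  moreover have "0 \<le> A * w" using assms by simp
  ultimately show ?thesis by (simp add: algebra_simps power2_eq_square)
qed

text \<open>The largest \<open>a n\<close> over the whole horizon absorbs the implicit right-hand side.\<close>

lemma accumulated_error_bound:
  fixes a b c e gap t l :: "nat \<Rightarrow> real"
  assumes a: "\<And>k. 0 \<le> a k" and c: "\<And>k. 0 \<le> c k" and e: "\<And>k. 0 \<le> e k"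
    and gap: "\<And>k. 0 \<le> gap k"
    and t: "\<And>k. 0 < t k" "mono t" and l: "\<And>k. 0 < l k" "mono l"
    and b0: "0 \<le> b 0"
    and step: "\<And>k. gap k \<le> ((a k)\<^sup>2 - (a (Suc k))\<^sup>2) / (2 * t k)
                 + ((b k)\<^sup>2 - (b (Suc k))\<^sup>2) / (2 * l k) + c k * a (Suc k) + e k"
  shows "2 * t N * (\<Sum>k<N. gap k)
    \<le> (sqrt (t N / t 0) * a 0 + sqrt (t N / l 0) * b 0 + 2 * (\<Sum>k<N. t N * c k)
        + sqrt (2 * (\<Sum>k<N. t N * e k)))\<^sup>2"
proof -
  define C where "C = (\<Sum>k<N. t N * c k)"
  define E where "E = (\<Sum>k<N. t N * e k)"
  define U where "U = Max (a ` {..N})"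
  define w where "w = sqrt (t N / t 0) * a 0 + sqrt (t N / l 0) * b 0 + sqrt (2 * E)"
  have tN: "0 < t N" by (rule t(1))
  have C: "0 \<le> C" unfolding C_def using c tN by (intro sum_nonneg) (simp add: less_imp_le)
  have E: "0 \<le> E" unfolding E_def using e tN by (intro sum_nonneg) (simp add: less_imp_le)
  have aU: "a k \<le> U" if "k \<le> N" for k unfolding U_def using that by simp
  have U: "0 \<le> U" using a[of 0] aU[of 0] by simp
  have ratio: "0 \<le> t N / t 0" "0 \<le> t N / l 0" using t(1) l(1) by (simp_all add: less_imp_le)
  have w: "0 \<le> w" unfolding w_def using a b0 E ratio by simp
  \<comment> \<open>The square of a sum of nonnegative terms dominates the sum of their squares;
    this produces the square roots in the final bound.\<close>
  have w2: "t N / t 0 * (a 0)\<^sup>2 + t N / l 0 * (b 0)\<^sup>2 + 2 * E \<le> w\<^sup>2"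
  proof -
    define p q s where "p = sqrt (t N / t 0) * a 0" "q = sqrt (t N / l 0) * b 0" "s = sqrt (2 * E)"
    have "0 \<le> p" "0 \<le> q" "0 \<le> s" using a b0 E ratio by (simp_all add: p_q_s_def)
    then have "0 \<le> p * q" "0 \<le> p * s" "0 \<le> q * s" by simp_all
    then have "p\<^sup>2 + q\<^sup>2 + s\<^sup>2 \<le> (p + q + s)\<^sup>2"
      by (simp add: power2_eq_square algebra_simps)
    then show ?thesis
      using ratio E by (simp add: p_q_s_def w_def power_mult_distrib)
  qed
  \<comment> \<open>Stated for every \<open>n\<close> up to \<open>N\<close> but with right-hand
    side and weight tied to \<open>N\<close>, since it is applied both where \<open>a\<close> is
    largest and at \<open>N\<close>.\<close>
  have sum_bound: "(a n)\<^sup>2 + 2 * t N * (\<Sum>k<n. gap k) \<le> w\<^sup>2 + 2 * C * U" if n: "n \<le> N" for n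
  proof -
    have "(\<Sum>k<n. gap k) \<le> (\<Sum>k<n. ((a k)\<^sup>2 - (a (Suc k))\<^sup>2) * (1 / (2 * t k)))
        + (\<Sum>k<n. ((b k)\<^sup>2 - (b (Suc k))\<^sup>2) * (1 / (2 * l k)))
        + (\<Sum>k<n. c k * a (Suc k)) + (\<Sum>k<n. e k)"
      using sum_mono[of "{..<n}", OF step] by (simp add: sum.distrib)
    moreover have "(\<Sum>k<n. ((a k)\<^sup>2 - (a (Suc k))\<^sup>2) * (1 / (2 * t k)))
        \<le> (a 0)\<^sup>2 * (1 / (2 * t 0)) - (a n)\<^sup>2 * (1 / (2 * t n))"
      by (rule telescope_decreasing_weights)
        (use t in \<open>auto intro!: divide_left_mono mult_pos_pos simp: incseq_SucD\<close>)
    moreover have "(\<Sum>k<n. ((b k)\<^sup>2 - (b (Suc k))\<^sup>2) * (1 / (2 * l k)))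
        \<le> (b 0)\<^sup>2 * (1 / (2 * l 0)) - (b n)\<^sup>2 * (1 / (2 * l n))"
      by (rule telescope_decreasing_weights)
        (use l in \<open>auto intro!: divide_left_mono mult_pos_pos simp: incseq_SucD\<close>)
    moreover have "0 \<le> (b n)\<^sup>2 * (1 / (2 * l n))" using l(1) by (simp add: less_imp_le)
    moreover have "(a n)\<^sup>2 * (1 / (2 * t N)) \<le> (a n)\<^sup>2 * (1 / (2 * t n))"
      using monoD[OF t(2) n] t(1) by (intro mult_left_mono divide_left_mono mult_pos_pos) auto
    moreover have "(\<Sum>k<n. c k * a (Suc k)) \<le> (\<Sum>k<N. c k) * U"
    proof -
      have "(\<Sum>k<n. c k * a (Suc k)) \<le> (\<Sum>k<n. c k * U)"
        using aU n c by (intro sum_mono mult_left_mono) auto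
      also have "\<dots> \<le> (\<Sum>k<N. c k * U)"
        using c U n by (intro sum_mono2) auto
      finally show ?thesis by (simp add: sum_distrib_right)
    qed
    moreover have "(\<Sum>k<n. e k) \<le> (\<Sum>k<N. e k)"
      using e n by (intro sum_mono2) auto
    ultimately have "(a n)\<^sup>2 * (1 / (2 * t N)) + (\<Sum>k<n. gap k)
        \<le> (a 0)\<^sup>2 * (1 / (2 * t 0)) + (b 0)\<^sup>2 * (1 / (2 * l 0)) + (\<Sum>k<N. c k) * U + (\<Sum>k<N. e k)"
      by linarith
    then have "2 * t N * ((a n)\<^sup>2 * (1 / (2 * t N)) + (\<Sum>k<n. gap k))
        \<le> 2 * t N * ((a 0)\<^sup>2 * (1 / (2 * t 0)) + (b 0)\<^sup>2 * (1 / (2 * l 0))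
            + (\<Sum>k<N. c k) * U + (\<Sum>k<N. e k))"
      using tN by (intro mult_left_mono) auto
    moreover have "2 * t N * ((a n)\<^sup>2 * (1 / (2 * t N)) + (\<Sum>k<n. gap k))
        = (a n)\<^sup>2 + 2 * t N * (\<Sum>k<n. gap k)"
      using tN by (simp add: distrib_left)
    moreover have "2 * t N * ((a 0)\<^sup>2 * (1 / (2 * t 0)) + (b 0)\<^sup>2 * (1 / (2 * l 0))
            + (\<Sum>k<N. c k) * U + (\<Sum>k<N. e k))
        = t N / t 0 * (a 0)\<^sup>2 + t N / l 0 * (b 0)\<^sup>2 + 2 * C * U + 2 * E"
      by (simp add: C_def E_def flip: sum_distrib_left) (simp add: algebra_simps)
    ultimately show ?thesis using w2 by linarith
  qed
  \<comment> \<open>At a maximizing index the nonnegative gaps are dropped, leaving a quadratic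
    inequality for \<open>U\<close>. At \<open>N\<close> the distance is dropped and the gaps are
    kept.\<close>
  have "U \<in> a ` {..N}" unfolding U_def by (rule Max_in) auto
  then obtain n where n: "n \<le> N" "U = a n" by auto
  have "0 \<le> 2 * t N * (\<Sum>k<n. gap k)" using gap tN by (simp add: sum_nonneg less_imp_le)
  then have "U\<^sup>2 \<le> w\<^sup>2 + 2 * C * U" using sum_bound[OF n(1)] unfolding n(2)[symmetric] by linarith
  then have "w\<^sup>2 + 2 * C * U \<le> (2 * C + w)\<^sup>2"
    by (rule quadratic_growth_bound[OF C w U])
  moreover have "2 * t N * (\<Sum>k<N. gap k) \<le> w\<^sup>2 + 2 * C * U"
    using sum_bound[of N] zero_le_power2[of "a N"] by linarith
  ultimately show ?thesis by (simp add: w_def C_def E_def algebra_simps)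
qed

section \<open>The gap at the averaged iterates\<close>

lemma Lagr_eq_ereal:
  assumes "proper f" "proper g" "u \<in> edom f" "v \<in> edom g"
  shows "Lagr f g A u v
           = ereal (real_of_ereal (f u) + (A *v u) \<bullet> v - real_of_ereal (g v))"
proof -
  obtain b c where "f u = ereal b" "g v = ereal c"
    using proper_real_ereal[OF assms(1,3)] proper_real_ereal[OF assms(2,4)] by metis
  then show ?thesis by (simp add: Lagr_def)
qed

theorem lemma3p4:
  fixes f :: "real^'m \<Rightarrow> ereal" and g :: "real^'n \<Rightarrow> ereal"
    and A :: "real^'m^'n" and R S :: "real^'n^'n"
    and \<tau> lam \<epsilon> \<delta> :: "nat \<Rightarrow> real"
    and x :: "nat \<Rightarrow> real^'m" and y yb :: "nat \<Rightarrow> real^'n"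
    and xs :: "real^'m" and ys :: "real^'n" and N :: nat
  assumes "proper f" and "lower_semicontinuous f" and "convex_fun f"
    and "proper g" and "lower_semicontinuous g" and "convex_fun g"
    and "pos_def R" and "pos_def S" and "pos_def (transpose A ** R ** A)"
    and "\<And>k. \<tau> k > 0" and "\<And>k. lam k > 0" and "mono \<tau>" and "mono lam"
    and "\<And>k. pos_def (R - (\<tau> k * lam k) *\<^sub>R matrix_inv S)"
    and "\<And>k. k \<ge> 1 \<Longrightarrow> \<epsilon> k \<ge> 0" and "\<And>k. k \<ge> 1 \<Longrightarrow> \<delta> k \<ge> 0"
    and "inexact_pd_seq f g A R S \<tau> lam \<epsilon> \<delta> x y yb"
    and "saddle_point f g A xs ys"
    and "N \<ge> 1"
  shows
    "let xh = (1 / real N) *\<^sub>R (\<Sum>k<N. x (Suc k));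
         yh = (1 / real N) *\<^sub>R (\<Sum>k<N. y (Suc k));
         A\<^sub>N = (\<Sum>k<N. \<tau> N * sqrt (\<epsilon> (Suc k) / \<tau> k));
         B\<^sub>N = (\<Sum>k<N. \<tau> N * (2 * \<epsilon> (Suc k) + \<delta> (Suc k)))
     in Lagr f g A xh ys - Lagr f g A xs yh
          \<le> ereal (1 / (2 * real N * \<tau> N) *
               (sqrt (\<tau> N / \<tau> 0) * wnorm S (ys - yb 0)
                + sqrt (\<tau> N / lam 0) * wnorm (transpose A ** R ** A) (xs - x 0)
                + 2 * A\<^sub>N + sqrt (2 * B\<^sub>N))\<^sup>2)"
proof -
  let ?F = "\<lambda>z. real_of_ereal (f z)" and ?G = "\<lambda>z. real_of_ereal (g z)"
  let ?M = "transpose A ** R ** A"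
  define gap where "gap k = ?F (x (Suc k)) + (A *v x (Suc k)) \<bullet> ys - ?G ys
      - (?F xs + (A *v xs) \<bullet> y (Suc k) - ?G (y (Suc k)))" for k
  define xh where "xh = (1 / real N) *\<^sub>R (\<Sum>k<N. x (Suc k))"
  define yh where "yh = (1 / real N) *\<^sub>R (\<Sum>k<N. y (Suc k))"
  define T where "T = sqrt (\<tau> N / \<tau> 0) * wnorm S (ys - yb 0)
      + sqrt (\<tau> N / lam 0) * wnorm ?M (xs - x 0)
      + 2 * (\<Sum>k<N. \<tau> N * sqrt (\<epsilon> (Suc k) / \<tau> k))
      + sqrt (2 * (\<Sum>k<N. \<tau> N * (2 * \<epsilon> (Suc k) + \<delta> (Suc k))))"
  have xs: "xs \<in> edom f" and ys: "ys \<in> edom g"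
    and saddle: "\<And>u v. Lagr f g A xs v \<le> Lagr f g A xs ys \<and> Lagr f g A xs ys \<le> Lagr f g A u ys"
    using assms(18) by (auto simp: saddle_point_def)
  have y_incl: "(1 / \<tau> k) *\<^sub>R (S *v (yb k - y (Suc k))) + A *v x k
         \<in> eps_subdiff (\<epsilon> (Suc k) / 2) g (y (Suc k))"
    and x_incl: "(1 / lam k) *\<^sub>R (?M *v (x k - x (Suc k))) - transpose A *v y (Suc k)
         \<in> eps_subdiff (\<delta> (Suc k)) f (x (Suc k))"
    and yb_incl: "0 \<in> eps_subdiff (\<epsilon> (Suc k) / 2)
             (\<lambda>v. g v - ereal ((A *v x (Suc k)) \<bullet> v)
                   + ereal (1 / (2 * \<tau> k) * (wnorm S (v - yb k))\<^sup>2))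
             (yb (Suc k))" for k
    using assms(17) unfolding inexact_pd_seq_def by blast+
  have domx: "x (Suc k) \<in> edom f" and domy: "y (Suc k) \<in> edom g" for k
    using x_incl[of k] y_incl[of k] by (simp_all add: eps_subdiff_def)
  have eps: "0 \<le> \<epsilon> (Suc k)" and del: "0 \<le> \<delta> (Suc k)" for k
    using assms(15,16) by simp_all
  \<comment> \<open>The two saddle inequalities, taken at the iterates, are chained through the
    value at the saddle point.\<close>
  have gap_nonneg: "0 \<le> gap k" for k
    using order_trans[OF saddle[of "y (Suc k)", THEN conjunct1] saddle[of _ "x (Suc k)", THEN conjunct2]]
    by (simp add: Lagr_eq_ereal[OF assms(1,4)] xs ys domx domy gap_def)
  \<comment> \<open>The error \<open>\<epsilon> (Suc k)\<close> from \<open>pd_step\<close> is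
    relaxed to twice its size, the form in which it enters the final bound.\<close>
  have step: "gap k \<le> ((wnorm S (ys - yb k))\<^sup>2 - (wnorm S (ys - yb (Suc k)))\<^sup>2) / (2 * \<tau> k)
      + ((wnorm ?M (xs - x k))\<^sup>2 - (wnorm ?M (xs - x (Suc k)))\<^sup>2) / (2 * lam k)
      + sqrt (\<epsilon> (Suc k) / \<tau> k) * wnorm S (ys - yb (Suc k)) + (2 * \<epsilon> (Suc k) + \<delta> (Suc k))" for k
    using pd_step[OF assms(1,4,6,8,9,10,11) eps assms(14) y_incl x_incl yb_incl xs ys, of k]
      eps[of k] unfolding gap_def by linarith
  have bound: "2 * \<tau> N * (\<Sum>k<N. gap k) \<le> T\<^sup>2"
    unfolding T_def
    by (rule accumulated_error_bound[where a = "\<lambda>k. wnorm S (ys - yb k)"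
          and b = "\<lambda>k. wnorm ?M (xs - x k)" and l = lam])
      (use assms(10-13) eps del gap_nonneg step in
        \<open>auto simp: wnorm_nonneg[OF assms(8)] wnorm_nonneg[OF assms(9)] less_imp_le\<close>)
  have xh: "xh \<in> edom f" "?F xh \<le> (1 / real N) * (\<Sum>k<N. ?F (x (Suc k)))"
    unfolding xh_def by (rule convex_fun_average[OF assms(1,3,19) domx])+
  have yh: "yh \<in> edom g" "?G yh \<le> (1 / real N) * (\<Sum>k<N. ?G (y (Suc k)))"
    unfolding yh_def by (rule convex_fun_average[OF assms(4,6,19) domy])+
  \<comment> \<open>The coupling terms average exactly, being linear; \<open>f\<close> and
    \<open>g\<close> contribute Jensen's inequality, both with the sign required for the
    gap.\<close>
  have "(A *v xh) \<bullet> ys = (1 / real N) * (\<Sum>k<N. (A *v x (Suc k)) \<bullet> ys)"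
    by (simp add: xh_def matrix_vector_mult_scaleR inner_sum_left linear_sum matrix_vector_mul_linear
        sum_divide_distrib)
  moreover have "(A *v xs) \<bullet> yh = (1 / real N) * (\<Sum>k<N. (A *v xs) \<bullet> y (Suc k))"
    by (simp add: yh_def inner_sum_right)
  moreover have "(1 / real N) * (\<Sum>k<N. gap k)
      = (1 / real N) * (\<Sum>k<N. ?F (x (Suc k))) + (1 / real N) * (\<Sum>k<N. (A *v x (Suc k)) \<bullet> ys) - ?G ys
        - (?F xs + (1 / real N) * (\<Sum>k<N. (A *v xs) \<bullet> y (Suc k))
            - (1 / real N) * (\<Sum>k<N. ?G (y (Suc k))))"
    using assms(19) by (simp add: gap_def sum.distrib sum_subtractf field_simps)
  ultimately have "?F xh + (A *v xh) \<bullet> ys - ?G ys - (?F xs + (A *v xs) \<bullet> yh - ?G yh)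
      \<le> (1 / real N) * (\<Sum>k<N. gap k)"
    using xh(2) yh(2) by linarith
  also have "\<dots> = 1 / (2 * real N * \<tau> N) * (2 * \<tau> N * (\<Sum>k<N. gap k))"
    using assms(10)[of N] by simp
  also have "\<dots> \<le> 1 / (2 * real N * \<tau> N) * T\<^sup>2"
    using bound assms(10)[of N] by (intro mult_left_mono) auto
  finally show ?thesis
    unfolding Let_def xh_def[symmetric] yh_def[symmetric] T_def[symmetric]
      Lagr_eq_ereal[OF assms(1,4) xh(1) ys] Lagr_eq_ereal[OF assms(1,4) xs yh(1)]
    by simp
qed

end
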